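(* Let $Y$ be a homogeneous continuum. Then $Y$ is indecomposable if and only if $Y$ is filament additive, $Y$ is filamentable, and every filament composant of $Y$ is singular dense in $Y$.
   Context: A continuum is a connected compact metrizable space with more than one point. A subcontinuum of a continuum $Y$ is a non-empty compact connected subset of $Y$ (one-point subsets are allowed). A continuum $Y$ is decomposable if $Y=H\cup K$ for some two proper subcontinua $H,K\subsetneq Y$; otherwise it is indecomposable. $Y$ is homogeneous if for every two points $x,y\in Y$ there is a homeomorphism of $Y$ onto itself mapping $x$ to $y$. A subcontinuum $K$ of $Y$ is filament if there is a neighborhood $N$ of $K$ in $Y$ (a set whose interior contains $K$) such that the connected component of $N$ containing $K$ is nowhere dense in $Y$. The filament composant of $x\in Y$ is the union of all filament subcontinua of $Y$ containing $x$. A subset $X\subseteq Y$ is a filament set if every subcontinuum of $Y$ contained in $X$ is filament. $Y$ is filament additive if the union of every two intersecting filament subcontinua of $Y$ is filament. $Y$ is filamentable if there is a filament subcontinuum $L\subseteq Y$ such that $Y\setminus L$ is a filament set. A connected subset $X$ of $Y$ is singular with respect to a point $y\in Y$ if for every connected $C\subseteq X$ such that $y$ belongs to the closure of $C$ in $Y$, the closure of $C$ in $X$ equals $X$. $X$ is singular in $Y$ if it is singular with respect to some $y\in Y$, and singular dense in $Y$ if it is both singular in $Y$ and dense in $Y$. *)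

theory Defs
  imports "HOL-Analysis.Analysis"
begin

definition continuum :: "'a topology \<Rightarrow> bool" where
  "continuum Y \<longleftrightarrow> compact_space Y \<and> connected_space Y \<and> metrizable_space Y \<and>
     (\<exists>x\<in>topspace Y. \<exists>y\<in>topspace Y. x \<noteq> y)"

(* One-point subcontinua are allowed, unlike in continuum. *)
definition subcontinuum :: "'a topology \<Rightarrow> 'a set \<Rightarrow> bool" where
  "subcontinuum Y K \<longleftrightarrow> K \<noteq> {} \<and> compactin Y K \<and> connectedin Y K"

definition decomposable :: "'a topology \<Rightarrow> bool" where
  "decomposable Y \<longleftrightarrow>
     (\<exists>H K. subcontinuum Y H \<and> subcontinuum Y K \<and>
            H \<subset> topspace Y \<and> K \<subset> topspace Y \<and> topspace Y = H \<union> K)"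

definition indecomposable :: "'a topology \<Rightarrow> bool" where
  "indecomposable Y \<longleftrightarrow> \<not> decomposable Y"

definition homogeneous :: "'a topology \<Rightarrow> bool" where
  "homogeneous Y \<longleftrightarrow>
     (\<forall>x\<in>topspace Y. \<forall>y\<in>topspace Y. \<exists>h. homeomorphic_map Y Y h \<and> h x = y)"

definition nowhere_densein :: "'a topology \<Rightarrow> 'a set \<Rightarrow> bool" where
  "nowhere_densein Y S \<longleftrightarrow> S \<subseteq> topspace Y \<and> Y interior_of (Y closure_of S) = {}"

(* As K is non-empty and connected, exactly one component C of N contains it. *)
definition filament :: "'a topology \<Rightarrow> 'a set \<Rightarrow> bool" where
  "filament Y K \<longleftrightarrow> subcontinuum Y K \<and>
     (\<exists>N C. N \<subseteq> topspace Y \<and> K \<subseteq> Y interior_of N \<and>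
            C \<in> connected_components_of (subtopology Y N) \<and> K \<subseteq> C \<and>
            nowhere_densein Y C)"

definition filament_composant :: "'a topology \<Rightarrow> 'a \<Rightarrow> 'a set" where
  "filament_composant Y x = \<Union>{K. filament Y K \<and> x \<in> K}"

definition filament_set :: "'a topology \<Rightarrow> 'a set \<Rightarrow> bool" where
  "filament_set Y X \<longleftrightarrow> X \<subseteq> topspace Y \<and>
     (\<forall>K. subcontinuum Y K \<and> K \<subseteq> X \<longrightarrow> filament Y K)"

definition filament_additive :: "'a topology \<Rightarrow> bool" where
  "filament_additive Y \<longleftrightarrow>
     (\<forall>K L. filament Y K \<and> filament Y L \<and> K \<inter> L \<noteq> {} \<longrightarrow> filament Y (K \<union> L))"

definition filamentable :: "'a topology \<Rightarrow> bool" where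
  "filamentable Y \<longleftrightarrow> (\<exists>L. filament Y L \<and> filament_set Y (topspace Y - L))"

definition singular_wrt :: "'a topology \<Rightarrow> 'a set \<Rightarrow> 'a \<Rightarrow> bool" where
  "singular_wrt Y X y \<longleftrightarrow> connectedin Y X \<and> y \<in> topspace Y \<and>
     (\<forall>C. C \<subseteq> X \<and> connectedin Y C \<and> y \<in> Y closure_of C \<longrightarrow>
          subtopology Y X closure_of C = X)"

definition singular_in :: "'a topology \<Rightarrow> 'a set \<Rightarrow> bool" where
  "singular_in Y X \<longleftrightarrow> (\<exists>y\<in>topspace Y. singular_wrt Y X y)"

definition singular_dense_in :: "'a topology \<Rightarrow> 'a set \<Rightarrow> bool" where
  "singular_dense_in Y X \<longleftrightarrow> singular_in Y X \<and> Y closure_of X = topspace Y"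

end

(* If Y is indecomposable, its filament subcontinua are exactly its proper subcontinua, so the
   filament composants are the usual composants. These are dense by boundary bumping and, being
   countable unions of nowhere dense continua, miss some point y; a composant is singular with
   respect to any such y, since a connected subset whose closure contains y cannot have a proper
   closure.

   If Y is decomposable, it has a proper subcontinuum with non-empty interior, hence a proper
   non-filament one, and by Zorn's lemma a minimal non-filament subcontinuum M. Take a filament
   composant X that is singular with respect to a point y; by homogeneity y may be assumed to lie
   in M. Filamentability and homogeneity yield a filament continuum inside X that meets every
   non-filament one, so X meets M, say in p. The composant of p in M is a union of filament
   continua and hence lies in X, and it is dense in M, which contains y. By singularity it is
   dense in X, hence in Y, so M = Y, a contradiction. *)

theory Submission
  imports Defs
begin

section \<open>Subcontinua of compact Hausdorff spaces\<close>

lemma subcontinuum_closedin: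
  "Hausdorff_space Y \<Longrightarrow> subcontinuum Y K \<Longrightarrow> closedin Y K"
  by (simp add: subcontinuum_def compactin_imp_closedin)

lemma subcontinuum_subset_topspace: "subcontinuum Y K \<Longrightarrow> K \<subseteq> topspace Y"
  by (simp add: subcontinuum_def compactin_subset_topspace)

lemma subcontinuum_Un:
  "subcontinuum Y K \<Longrightarrow> subcontinuum Y L \<Longrightarrow> K \<inter> L \<noteq> {} \<Longrightarrow> subcontinuum Y (K \<union> L)"
  by (simp add: subcontinuum_def compactin_Un connectedin_Un)

lemma subcontinuum_singleton: "x \<in> topspace Y \<Longrightarrow> subcontinuum Y {x}"
  by (simp add: subcontinuum_def)

lemma subcontinuum_subtopology:
  "subcontinuum (subtopology Y M) K \<longleftrightarrow> subcontinuum Y K \<and> K \<subseteq> M"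
  by (auto simp: subcontinuum_def compactin_subtopology connectedin_subtopology)

lemma subcontinuum_closure_of:
  assumes "compact_space Y" "connectedin Y C" "C \<noteq> {}"
  shows "subcontinuum Y (Y closure_of C)"
  using assms connectedin_subset_topspace [of Y C]
  by (auto simp: subcontinuum_def closedin_compact_space connectedin_closure_of closure_of_eq_empty)

lemma subcontinuum_image:
  assumes "homeomorphic_map Y Y h" "subcontinuum Y K"
  shows "subcontinuum Y (h ` K)"
  using assms
  by (metis homeomorphic_map_compactness_eq homeomorphic_map_connectedness_eq image_is_empty
      subcontinuum_def)

text \<open>Compactness: if no member lay inside \<open>U\<close>, the closed sets
  \<open>K - U\<close> would have the finite intersection property, so \<open>\<Inter>\<C>\<close>
  would have a point outside \<open>U\<close>. This transfers open properties of the intersection to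
  some member of the chain.\<close>

lemma chain_Inter_subset_openin:
  assumes "compact_space Y" "\<C> \<noteq> {}"
    and clo: "\<And>K. K \<in> \<C> \<Longrightarrow> closedin Y K"
    and chain: "\<And>K L. K \<in> \<C> \<Longrightarrow> L \<in> \<C> \<Longrightarrow> K \<subseteq> L \<or> L \<subseteq> K"
    and "openin Y U" "\<Inter>\<C> \<subseteq> U"
  shows "\<exists>K\<in>\<C>. K \<subseteq> U"
proof (rule ccontr)
  assume neg: "\<not> ?thesis"
  define \<D> where "\<D> = (\<lambda>K. K - U) ` \<C>"
  \<comment> \<open>In a chain every finite subfamily is bounded below by a member of the chain; the
    empty subfamily is where \<open>\<C> \<noteq> {}\<close> enters.\<close>
  have *: "\<exists>L\<in>\<C>. \<forall>K\<in>\<F>. L \<subseteq> K" if "finite \<F>" "\<F> \<subseteq> \<C>" for \<F>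
    using that
  proof (induction \<F> rule: finite_induct)
    case empty
    then show ?case using \<open>\<C> \<noteq> {}\<close> by auto
  next
    case (insert K \<F>)
    then obtain L where "L \<in> \<C>" "\<forall>K\<in>\<F>. L \<subseteq> K" by auto
    with insert.prems chain [of K L] show ?case
      by (metis insert_iff insert_subset order_refl order_trans)
  qed
  have "\<Inter>\<F> \<noteq> {}" if fin: "finite \<F>" and sub: "\<F> \<subseteq> \<D>" for \<F>
  proof -
    obtain \<G> where \<G>: "\<G> \<subseteq> \<C>" "finite \<G>" "\<F> = (\<lambda>K. K - U) ` \<G>"
      using finite_subset_image [OF fin sub [unfolded \<D>_def]] by blast
    obtain L where "L \<in> \<C>" "\<forall>K\<in>\<G>. L \<subseteq> K"
      using * \<G> by blast
    then have "L - U \<subseteq> \<Inter>\<F>" "L - U \<noteq> {}"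
      using \<G> neg by auto
    then show ?thesis by blast
  qed
  moreover have "\<forall>D\<in>\<D>. closedin Y D"
    using clo \<open>openin Y U\<close> by (auto simp: \<D>_def closedin_diff)
  ultimately have "\<Inter>\<D> \<noteq> {}"
    using \<open>compact_space Y\<close> [unfolded compact_space_fip, rule_format, of \<D>] by blast
  moreover have "\<Inter>\<D> \<subseteq> \<Inter>\<C> - U"
    using \<open>\<C> \<noteq> {}\<close> by (auto simp: \<D>_def)
  ultimately show False
    using \<open>\<Inter>\<C> \<subseteq> U\<close> by blast
qed

text \<open>Normality extends a separation of the intersection to disjoint open sets
  \<open>U\<close> and \<open>V\<close>. Some member of the chain already lies in
  \<open>U \<union> V\<close> and meets both, contradicting its connectedness.\<close>

lemma subcontinuum_chain_Inter:
  assumes Y: "compact_space Y" "Hausdorff_space Y" and "\<C> \<noteq> {}"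
    and sub: "\<And>K. K \<in> \<C> \<Longrightarrow> subcontinuum Y K"
    and chain: "\<And>K L. K \<in> \<C> \<Longrightarrow> L \<in> \<C> \<Longrightarrow> K \<subseteq> L \<or> L \<subseteq> K"
  shows "subcontinuum Y (\<Inter>\<C>)"
proof -
  have clo: "closedin Y K" if "K \<in> \<C>" for K
    using Y sub subcontinuum_closedin that by blast
  have cloI: "closedin Y (\<Inter>\<C>)"
    using clo \<open>\<C> \<noteq> {}\<close> by blast
  note nbhd = chain_Inter_subset_openin [OF Y(1) \<open>\<C> \<noteq> {}\<close> clo chain]
  \<comment> \<open>With the open set \<open>{}\<close>, an empty intersection would force an empty
    member.\<close>
  have "\<Inter>\<C> \<noteq> {}"
    using nbhd [of "{}"] sub by (force simp: subcontinuum_def)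
  moreover have "connectedin Y (\<Inter>\<C>)"
    unfolding connectedin_closedin
  proof (intro conjI notI)
    show "\<Inter>\<C> \<subseteq> topspace Y"
      using cloI closedin_subset by blast
    assume "\<exists>E1 E2. closedin Y E1 \<and> closedin Y E2 \<and> \<Inter>\<C> \<subseteq> E1 \<union> E2 \<and> E1 \<inter> E2 \<inter> \<Inter>\<C> = {} \<and>
              E1 \<inter> \<Inter>\<C> \<noteq> {} \<and> E2 \<inter> \<Inter>\<C> \<noteq> {}"
    then obtain E1 E2 where E: "closedin Y E1" "closedin Y E2" "\<Inter>\<C> \<subseteq> E1 \<union> E2"
      "E1 \<inter> E2 \<inter> \<Inter>\<C> = {}" "E1 \<inter> \<Inter>\<C> \<noteq> {}" "E2 \<inter> \<Inter>\<C> \<noteq> {}"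
      by blast
    have "normal_space Y"
      using Y compact_Hausdorff_or_regular_imp_normal_space by blast
    moreover have "closedin Y (E1 \<inter> \<Inter>\<C>)" "closedin Y (E2 \<inter> \<Inter>\<C>)"
      "disjnt (E1 \<inter> \<Inter>\<C>) (E2 \<inter> \<Inter>\<C>)"
      using E cloI by (blast, blast, auto simp: disjnt_def)
    ultimately obtain U V where UV: "openin Y U" "openin Y V" "E1 \<inter> \<Inter>\<C> \<subseteq> U" "E2 \<inter> \<Inter>\<C> \<subseteq> V"
      "disjnt U V"
      unfolding normal_space_def by meson
    then obtain K where K: "K \<in> \<C>" "K \<subseteq> U \<union> V"
      using nbhd [of "U \<union> V"] E(3) by blast
    have "U \<inter> K \<noteq> {}" "V \<inter> K \<noteq> {}"
      using E(5,6) UV(3,4) K(1) by blast+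
    moreover have "connectedin Y K"
      using sub K by (simp add: subcontinuum_def)
    moreover have "U \<inter> V \<inter> K = {}"
      using UV(5) by (auto simp: disjnt_def)
    ultimately show False
      using K(2) UV(1,2) unfolding connectedin by meson
  qed
  ultimately show ?thesis
    using cloI Y by (simp add: subcontinuum_def closedin_compact_space)
qed

text \<open>If \<open>x\<close> is not in \<open>U\<close>, remove a small open \<open>V\<close>
  whose closure lies in \<open>U\<close>. By boundary bumping the component of \<open>x\<close> in
  the complement of \<open>V\<close> reaches the frontier of that complement, hence
  \<open>U\<close>, while it still misses \<open>V\<close>.\<close>

lemma subcontinuum_meets_openin:
  assumes Y: "compact_space Y" "connected_space Y" "Hausdorff_space Y"
    and x: "x \<in> topspace Y" and "topspace Y \<noteq> {x}" and U: "openin Y U" "U \<noteq> {}"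
  shows "\<exists>K. subcontinuum Y K \<and> K \<noteq> topspace Y \<and> x \<in> K \<and> K \<inter> U \<noteq> {}"
proof (cases "x \<in> U")
  case True
  then show ?thesis
    using assms subcontinuum_singleton [OF x] by (intro exI [of _ "{x}"]) auto
next
  case False
  obtain u where u: "u \<in> U"
    using U by blast
  have "normal_space Y" and "closedin Y {u}"
    using Y U u openin_subset [of Y U]
    by (auto simp: compact_Hausdorff_or_regular_imp_normal_space closedin_Hausdorff_singleton)
  then obtain V where V: "openin Y V" "u \<in> V" "Y closure_of V \<subseteq> U"
    using U u unfolding normal_space_alt by (metis empty_subsetI insert_subset)
  define S where "S = topspace Y - V"
  have clS: "closedin Y S"
    using V by (simp add: S_def closedin_diff)
  have VY: "V \<subseteq> topspace Y" and VU: "V \<subseteq> U"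
    using V closure_of_subset [of V Y] openin_subset [of Y V] by auto
  define C where "C = connected_component_of_set (subtopology Y S) x"
  have xS: "x \<in> topspace (subtopology Y S)"
    using x False VU by (auto simp: S_def)
  have C: "C \<in> connected_components_of (subtopology Y S)"
    unfolding C_def using xS by (simp add: connected_component_in_connected_components_of)
  have "C \<inter> Y frontier_of S \<noteq> {}"
    using boundary_bumping_theorem_closed [OF Y(2,1,3) clS _ C] V VY by (auto simp: S_def)
  moreover have "Y frontier_of S \<subseteq> U"
    using V(3) by (simp add: S_def frontier_of_complement) (auto simp: frontier_of_def)
  moreover have "x \<in> C"
    using xS by (simp add: C_def connected_component_of_refl)
  moreover have "C \<subseteq> S" "closedin Y C"
    using C clS closedin_connected_components_of closedin_trans_full connected_components_of_subset
    by fastforce+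
  moreover have "connectedin Y C"
    using C connectedin_connected_components_of connectedin_subtopology by blast
  ultimately show ?thesis
    using V VY Y closedin_compact_space
    by (intro exI [of _ C]) (auto simp: subcontinuum_def S_def)
qed

section \<open>Composants and their density\<close>

definition composant :: "'a topology \<Rightarrow> 'a \<Rightarrow> 'a set" where
  "composant Y x = \<Union>{K. subcontinuum Y K \<and> K \<noteq> topspace Y \<and> x \<in> K}"

lemma composant_subset_topspace: "composant Y x \<subseteq> topspace Y"
  using subcontinuum_subset_topspace by (fastforce simp: composant_def)

lemma connectedin_composant: "connectedin Y (composant Y x)"
  unfolding composant_def
  by (rule connectedin_Union) (auto simp: subcontinuum_def)

lemma composant_dense:
  assumes "compact_space Y" "connected_space Y" "Hausdorff_space Y"
    and "x \<in> topspace Y" "topspace Y \<noteq> {x}"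
  shows "Y closure_of (composant Y x) = topspace Y"
  unfolding dense_intersects_open composant_def
  using subcontinuum_meets_openin [OF assms] by blast

section \<open>Filament continua\<close>

lemma filament_imp_subcontinuum: "filament Y K \<Longrightarrow> subcontinuum Y K"
  by (simp add: filament_def)

text \<open>A continuum inside the interior of the witnessing neighbourhood \<open>N\<close> that
  meets \<open>M\<close> is absorbed by the component of \<open>N\<close> containing
  \<open>M\<close>, so the same \<open>N\<close> and component witness that it is filament.
  Monotonicity and the existence of minimal non-filament continua both rest on this.\<close>

lemma filament_neighbourhood:
  assumes "filament Y M"
  shows "\<exists>U. openin Y U \<and> M \<subseteq> U \<and>
           (\<forall>K. subcontinuum Y K \<and> K \<subseteq> U \<and> K \<inter> M \<noteq> {} \<longrightarrow> filament Y K)"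
proof -
  obtain N C where NC: "N \<subseteq> topspace Y" "M \<subseteq> Y interior_of N"
      "C \<in> connected_components_of (subtopology Y N)" "M \<subseteq> C" "nowhere_densein Y C"
    using assms by (auto simp: filament_def)
  have "filament Y K" if K: "subcontinuum Y K" "K \<subseteq> Y interior_of N" "K \<inter> M \<noteq> {}" for K
  proof -
    have "connectedin (subtopology Y N) K"
      using K interior_of_subset [of Y N] by (auto simp: subcontinuum_def connectedin_subtopology)
    moreover have "\<not> disjnt C K"
      using K NC by (auto simp: disjnt_def)
    ultimately have "K \<subseteq> C"
      using NC(3) connected_components_of_maximal by blast
    then show ?thesis
      using K NC unfolding filament_def by blast
  qed
  then show ?thesis
    using NC(2) openin_interior_of [of Y N] by (intro exI [of _ "Y interior_of N"]) simp
qed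

lemma filament_mono:
  assumes "filament Y K" "subcontinuum Y L" "L \<subseteq> K"
  shows "filament Y L"
proof -
  have "L \<inter> K \<noteq> {}"
    using assms by (auto simp: subcontinuum_def)
  then show ?thesis
    using filament_neighbourhood [OF assms(1)] assms(2,3) by (meson order_trans)
qed

lemma filament_interior_of_empty:
  assumes "filament Y K"
  shows "Y interior_of K = {}"
proof -
  obtain C where C: "K \<subseteq> C" "nowhere_densein Y C"
    using assms by (auto simp: filament_def)
  then have "K \<subseteq> Y closure_of C"
    using closure_of_subset by (fastforce simp: nowhere_densein_def)
  then show ?thesis
    using C interior_of_mono [of K "Y closure_of C" Y] by (auto simp: nowhere_densein_def)
qed

section \<open>Homeomorphism invariance and minimal non-filament continua\<close>

lemma filament_image:
  assumes h: "homeomorphic_map Y Y h" and "filament Y K"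
  shows "filament Y (h ` K)"
proof -
  obtain N C where NC: "N \<subseteq> topspace Y" "K \<subseteq> Y interior_of N"
      "C \<in> connected_components_of (subtopology Y N)" "K \<subseteq> C" "nowhere_densein Y C"
    using assms by (auto simp: filament_def)
  have hY: "h ` topspace Y = topspace Y"
    using h homeomorphic_imp_surjective_map by blast
  have "homeomorphic_map (subtopology Y N) (subtopology Y (h ` N)) h"
    using NC(1) hY by (intro homeomorphic_map_subtopologies [OF h]) (metis image_mono inf.absorb2)
  then have "h ` C \<in> connected_components_of (subtopology Y (h ` N))"
    using NC(3) by (simp add: homeomorphic_map_connected_components_of)
  moreover have "h ` N \<subseteq> topspace Y"
    using NC(1) hY by blast
  moreover have "h ` K \<subseteq> Y interior_of (h ` N)"
    using NC homeomorphic_map_interior_of [OF h] by auto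
  moreover have "nowhere_densein Y (h ` C)"
    using NC(5) hY h
    by (auto simp: nowhere_densein_def homeomorphic_map_closure_of [OF h]
        homeomorphic_map_interior_of [OF h] closure_of_subset_topspace)
  moreover have "subcontinuum Y (h ` K)"
    using assms filament_imp_subcontinuum subcontinuum_image by blast
  ultimately show ?thesis
    using NC(4) unfolding filament_def by blast
qed

lemma homeomorphic_map_inverse:
  assumes "homeomorphic_map X Y h"
  obtains g where "homeomorphic_map Y X g"
    "\<forall>x\<in>topspace X. g (h x) = x" "\<forall>y\<in>topspace Y. h (g y) = y"
proof -
  obtain g where "homeomorphic_maps X Y h g"
    using assms homeomorphic_map_maps [of X Y h] by blast
  then show thesis
    using that homeomorphic_maps_map [of X Y h g] by blast
qed

lemma filament_image_iff:
  assumes h: "homeomorphic_map Y Y h" and K: "K \<subseteq> topspace Y"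
  shows "filament Y (h ` K) \<longleftrightarrow> filament Y K"
proof
  obtain g where g: "homeomorphic_map Y Y g" "\<forall>x\<in>topspace Y. g (h x) = x"
    using homeomorphic_map_inverse h by blast
  then have "g ` h ` K = K"
    using K by (force simp: image_image)
  then show "filament Y (h ` K) \<Longrightarrow> filament Y K"
    using filament_image [OF g(1)] by metis
qed (use assms filament_image in blast)

text \<open>Zorn's lemma for reverse inclusion, with the intersection as bound of a non-empty chain.
  That intersection is not filament: otherwise some member of the chain would lie in the open set
  given by \<open>filament_neighbourhood\<close> and be filament itself.\<close>

lemma minimal_nonfilament_exists:
  assumes Y: "compact_space Y" "Hausdorff_space Y" and H: "subcontinuum Y H" "\<not> filament Y H"
  obtains M where "subcontinuum Y M" "M \<subseteq> H" "\<not> filament Y M"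
    "\<And>K. subcontinuum Y K \<Longrightarrow> K \<subset> M \<Longrightarrow> filament Y K"
proof -
  define \<A> where "\<A> = {K. subcontinuum Y K \<and> K \<subseteq> H \<and> \<not> filament Y K}"
  have "\<exists>M\<in>\<A>. \<forall>K\<in>\<A>. K \<subseteq> M \<longrightarrow> K = M"
  proof (rule predicate_Zorn)
    show "partial_order_on \<A> (relation_of (\<lambda>A B. B \<subseteq> A) \<A>)"
      by (rule partial_order_on_relation_ofI) auto
    fix \<C> assume "\<C> \<in> Chains (relation_of (\<lambda>A B. B \<subseteq> A) \<A>)"
    then have sub: "\<C> \<subseteq> \<A>" and chain: "\<And>K L. K \<in> \<C> \<Longrightarrow> L \<in> \<C> \<Longrightarrow> K \<subseteq> L \<or> L \<subseteq> K"
      unfolding Chains_def relation_of_def by blast+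
    show "\<exists>M\<in>\<A>. \<forall>K\<in>\<C>. M \<subseteq> K"
    proof (cases "\<C> = {}")
      case True
      then show ?thesis
        using H by (auto simp: \<A>_def)
    next
      case False
      have subc: "subcontinuum Y K" and clo: "closedin Y K" if "K \<in> \<C>" for K
        using that sub subcontinuum_closedin Y by (auto simp: \<A>_def)
      have I: "subcontinuum Y (\<Inter>\<C>)"
        using subcontinuum_chain_Inter [OF Y False subc chain] .
      have "\<not> filament Y (\<Inter>\<C>)"
      proof
        assume "filament Y (\<Inter>\<C>)"
        then obtain U where U: "openin Y U" "\<Inter>\<C> \<subseteq> U"
            "\<And>K. subcontinuum Y K \<Longrightarrow> K \<subseteq> U \<Longrightarrow> K \<inter> \<Inter>\<C> \<noteq> {} \<Longrightarrow> filament Y K"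
          using filament_neighbourhood by meson
        obtain K where "K \<in> \<C>" "K \<subseteq> U"
          using chain_Inter_subset_openin [OF Y(1) False clo chain U(1,2)] by blast
        moreover have "K \<inter> \<Inter>\<C> = \<Inter>\<C>"
          using \<open>K \<in> \<C>\<close> by blast
        ultimately have "filament Y K"
          using U(3) subc I by (simp add: subcontinuum_def)
        then show False
          using \<open>K \<in> \<C>\<close> sub by (auto simp: \<A>_def)
      qed
      moreover have "\<Inter>\<C> \<subseteq> H"
        using False sub by (auto simp: \<A>_def)
      ultimately show ?thesis
        using I by (intro bexI [of _ "\<Inter>\<C>"]) (auto simp: \<A>_def)
    qed
  qed
  then obtain M where "M \<in> \<A>" "\<forall>K\<in>\<A>. K \<subseteq> M \<longrightarrow> K = M" ..
  then show thesis
    by (intro that [of M]) (auto simp: \<A>_def)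
qed

text \<open>This lets homogeneity carry a minimal non-filament continuum to a prescribed point;
  subcontinua of the image are pulled back by the inverse homeomorphism.\<close>

lemma minimal_nonfilament_image:
  assumes h: "homeomorphic_map Y Y h" and M: "subcontinuum Y M" "\<not> filament Y M"
    and minimal: "\<And>K. subcontinuum Y K \<Longrightarrow> K \<subset> M \<Longrightarrow> filament Y K"
  shows "\<not> filament Y (h ` M)"
    and "\<And>K. subcontinuum Y K \<Longrightarrow> K \<subset> h ` M \<Longrightarrow> filament Y K"
proof -
  have MY: "M \<subseteq> topspace Y"
    using M subcontinuum_subset_topspace by blast
  then show "\<not> filament Y (h ` M)"
    using M h filament_image_iff by blast
  fix K assume K: "subcontinuum Y K" "K \<subset> h ` M"
  obtain g where g: "homeomorphic_map Y Y g" "\<forall>x\<in>topspace Y. g (h x) = x"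
      "\<forall>x\<in>topspace Y. h (g x) = x"
    using homeomorphic_map_inverse h by blast
  have KY: "K \<subseteq> topspace Y"
    using K subcontinuum_subset_topspace by blast
  have "g ` h ` M = M" "h ` g ` K = K"
    using g MY KY by (force simp: image_image)+
  then have "g ` K \<subset> M"
    using K by blast
  then have "filament Y (g ` K)"
    using minimal g(1) K subcontinuum_image by blast
  then show "filament Y K"
    using filament_image_iff [OF g(1) KY] by simp
qed

section \<open>Indecomposable continua\<close>

lemma indecomposable_union_proper:
  assumes "indecomposable Y" "subcontinuum Y K" "subcontinuum Y L"
    "K \<noteq> topspace Y" "L \<noteq> topspace Y"
  shows "K \<union> L \<noteq> topspace Y"
  using assms subcontinuum_subset_topspace unfolding indecomposable_def decomposable_def
  by (metis psubsetI)

text \<open>In a separation of \<open>K \<union> A\<close> the connected set \<open>K\<close> lies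
  in one piece. The other piece is then closed and also open in \<open>Y\<close>, which contradicts
  the connectedness of \<open>Y\<close>.\<close>

lemma connectedin_Un_complement_part:
  assumes Y: "connected_space Y" and K: "closedin Y K" "connectedin Y K" "K \<noteq> {}"
    and AB: "openin Y A" "openin Y B" "topspace Y = K \<union> A \<union> B" "A \<inter> B = {}" "K \<inter> A = {}" "K \<inter> B = {}"
  shows "closedin Y (K \<union> A)" "connectedin Y (K \<union> A)"
proof -
  have KA: "K \<union> A = topspace Y - B" and KB: "K \<union> B = topspace Y - A"
    using AB by auto
  then show cl: "closedin Y (K \<union> A)"
    using AB(2) by auto
  have clB: "closedin Y (K \<union> B)"
    using AB(1) KB by auto
  \<comment> \<open>Here \<open>E\<close> is the piece containing \<open>K\<close>. The piece
    \<open>F\<close> lies in \<open>A\<close>, and its complement is the union of the closed sets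
    \<open>E\<close> and \<open>K \<union> B\<close>.\<close>
  have no: False if E: "closedin Y E" "closedin Y F" "K \<union> A = E \<union> F" "E \<inter> F = {}" "K \<subseteq> E" "F \<noteq> {}" for E F
  proof -
    have "F = topspace Y - (E \<union> (K \<union> B))"
      using E AB by auto
    moreover have "closedin Y (E \<union> (K \<union> B))"
      using E clB by blast
    ultimately have "openin Y F"
      by auto
    then have "F = topspace Y"
      using E Y connected_space_clopen_in by blast
    then show False
      using E K closedin_subset by blast
  qed
  show "connectedin Y (K \<union> A)"
    unfolding connectedin_closedin
  proof (intro conjI notI)
    show "K \<union> A \<subseteq> topspace Y"
      using AB by auto
    assume "\<exists>E1 E2. closedin Y E1 \<and> closedin Y E2 \<and> K \<union> A \<subseteq> E1 \<union> E2 \<and>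
              E1 \<inter> E2 \<inter> (K \<union> A) = {} \<and> E1 \<inter> (K \<union> A) \<noteq> {} \<and> E2 \<inter> (K \<union> A) \<noteq> {}"
    then obtain E1 E2 where E: "closedin Y E1" "closedin Y E2" "K \<union> A \<subseteq> E1 \<union> E2"
        "E1 \<inter> E2 \<inter> (K \<union> A) = {}" "E1 \<inter> (K \<union> A) \<noteq> {}" "E2 \<inter> (K \<union> A) \<noteq> {}"
      by blast
    have "E1 \<inter> K = {} \<or> E2 \<inter> K = {}"
      using K(2) E unfolding connectedin_closedin by blast
    moreover have "closedin Y (E1 \<inter> (K \<union> A))" "closedin Y (E2 \<inter> (K \<union> A))"
      using E cl by blast+
    ultimately show False
      using no [of "E1 \<inter> (K \<union> A)" "E2 \<inter> (K \<union> A)"] no [of "E2 \<inter> (K \<union> A)" "E1 \<inter> (K \<union> A)"] E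
      by blast
  qed
qed

text \<open>If \<open>K\<close> had interior points, the closure of its complement \<open>D\<close>
  would be proper. For connected \<open>D\<close>, the sets \<open>K\<close> and closure of
  \<open>D\<close> decompose \<open>Y\<close>; if \<open>D\<close> splits into open sets
  \<open>A\<close> and \<open>B\<close>, then \<open>K \<union> A\<close> and
  \<open>K \<union> B\<close> do.\<close>

lemma indecomposable_interior_of_empty:
  assumes Y: "compact_space Y" "connected_space Y" "Hausdorff_space Y" "indecomposable Y"
    and K: "subcontinuum Y K" "K \<noteq> topspace Y"
  shows "Y interior_of K = {}"
proof (rule ccontr)
  assume int: "Y interior_of K \<noteq> {}"
  have clK: "closedin Y K" and KY: "K \<subseteq> topspace Y"
    using K Y subcontinuum_closedin subcontinuum_subset_topspace by blast+
  define D where "D = topspace Y - K"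
  have D: "openin Y D" "D \<noteq> {}" "D \<subseteq> topspace Y" "D \<inter> K = {}" "topspace Y = K \<union> D"
    using clK K KY by (auto simp: D_def)
  show False
  proof (cases "connectedin Y D")
    case True
    then have "subcontinuum Y (Y closure_of D)"
      using subcontinuum_closure_of Y D by blast
    moreover have "Y closure_of D \<noteq> topspace Y"
      using int by (simp add: D_def interior_of_closure_of closure_of_eq_topspace double_diff KY)
    ultimately have "K \<union> Y closure_of D \<noteq> topspace Y"
      using indecomposable_union_proper Y K by blast
    then show False
      using D closure_of_subset [of D Y] closure_of_subset_topspace [of Y D] by blast
  next
    case False
    then obtain E1 E2 where E: "openin Y E1" "openin Y E2" "D \<subseteq> E1 \<union> E2" "E1 \<inter> E2 \<inter> D = {}"
        "E1 \<inter> D \<noteq> {}" "E2 \<inter> D \<noteq> {}"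
      using D(3) unfolding connectedin by blast
    define A B where "A = E1 \<inter> D" and "B = E2 \<inter> D"
    have AB: "openin Y A" "openin Y B" "A \<inter> B = {}" "D = A \<union> B" "A \<noteq> {}" "B \<noteq> {}"
      using E D by (auto simp: A_def B_def)
    have Kc: "connectedin Y K" "K \<noteq> {}"
      using K by (auto simp: subcontinuum_def)
    have "closedin Y (K \<union> A)" "connectedin Y (K \<union> A)"
      by (rule connectedin_Un_complement_part [OF Y(2) clK Kc AB(1,2)]; use AB D in auto)+
    moreover have "closedin Y (K \<union> B)" "connectedin Y (K \<union> B)"
      by (rule connectedin_Un_complement_part [OF Y(2) clK Kc AB(2,1)]; use AB D in auto)+
    ultimately have "subcontinuum Y (K \<union> A)" "subcontinuum Y (K \<union> B)"
      using Kc Y closedin_compact_space by (auto simp: subcontinuum_def)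
    then have "(K \<union> A) \<union> (K \<union> B) \<noteq> topspace Y"
      by (rule indecomposable_union_proper [OF Y(4)]) (use AB D in auto)
    then show False
      using AB D by auto
  qed
qed

text \<open>A proper \<open>K\<close> has an open neighbourhood \<open>U\<close> whose closure omits
  a point \<open>p\<close>. The component of \<open>U\<close> containing \<open>K\<close> then has a
  proper subcontinuum as its closure, which has empty interior. The converse holds because
  \<open>topspace Y\<close> has non-empty interior.\<close>

lemma indecomposable_filament_iff:
  assumes Y: "compact_space Y" "connected_space Y" "Hausdorff_space Y" "indecomposable Y"
    and K: "subcontinuum Y K"
  shows "filament Y K \<longleftrightarrow> K \<noteq> topspace Y"
proof
  assume "filament Y K"
  then show "K \<noteq> topspace Y"
    using filament_interior_of_empty K by (fastforce simp: subcontinuum_def)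
next
  assume "K \<noteq> topspace Y"
  then obtain p where p: "p \<in> topspace Y" "p \<notin> K"
    using K subcontinuum_subset_topspace by blast
  have clK: "closedin Y K" and "normal_space Y"
    using K Y by (simp_all add: subcontinuum_closedin compact_Hausdorff_or_regular_imp_normal_space)
  moreover have "openin Y (topspace Y - {p})"
    using Y p by (simp add: closedin_Hausdorff_singleton openin_diff)
  moreover have "K \<subseteq> topspace Y - {p}"
    using K p subcontinuum_subset_topspace by fastforce
  ultimately obtain U where U: "openin Y U" "K \<subseteq> U" "Y closure_of U \<subseteq> topspace Y - {p}"
    unfolding normal_space_alt by meson
  have UY: "U \<subseteq> topspace Y"
    using U openin_subset by blast
  have Kc: "connectedin (subtopology Y U) K" "K \<noteq> {}"
    using K U by (auto simp: subcontinuum_def connectedin_subtopology)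
  then obtain x where x: "x \<in> K" by blast
  define C where "C = connected_component_of_set (subtopology Y U) x"
  have C: "C \<in> connected_components_of (subtopology Y U)"
    unfolding C_def using x U UY by (auto simp: connected_component_in_connected_components_of)
  have KC: "K \<subseteq> C"
    unfolding C_def using Kc x connected_component_of_maximal by metis
  have CU: "C \<subseteq> U" and "connectedin Y C"
    using C connected_components_of_subset connectedin_connected_components_of connectedin_subtopology
    by fastforce+
  then have "subcontinuum Y (Y closure_of C)"
    using subcontinuum_closure_of Y KC Kc by blast
  moreover have "Y closure_of C \<noteq> topspace Y"
    using closure_of_mono [OF CU, of Y] U p by blast
  ultimately have "nowhere_densein Y C"
    using indecomposable_interior_of_empty Y CU UY by (auto simp: nowhere_densein_def)
  then show "filament Y K"
    unfolding filament_def using K UY C KC U by (metis interior_of_openin)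
qed

text \<open>Total boundedness gives a finite net for each radius \<open>inverse (Suc n)\<close>;
  \<open>\<B>\<close> collects the balls around all these centres.\<close>

lemma compact_metrizable_countable_pi_base:
  assumes "compact_space Y" "metrizable_space Y"
  obtains \<B> where "countable \<B>" "\<And>B. B \<in> \<B> \<Longrightarrow> openin Y B \<and> B \<noteq> {}"
    "\<And>V. openin Y V \<Longrightarrow> V \<noteq> {} \<Longrightarrow> \<exists>B\<in>\<B>. B \<subseteq> V"
proof -
  obtain M d where "Metric_space M d" and Y: "Y = Metric_space.mtopology M d"
    using assms(2) unfolding metrizable_space_def by metis
  interpret Metric_space M d by fact
  have "mtotally_bounded M"
    using assms(1) Y compact_space_eq_mcomplete_mtotally_bounded by blast
  then have "\<forall>n. \<exists>F. finite F \<and> F \<subseteq> M \<and> M \<subseteq> (\<Union>x\<in>F. mball x (inverse (Suc n)))"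
    unfolding mtotally_bounded_def by simp
  then obtain F where F: "\<And>n. finite (F n)" "\<And>n. F n \<subseteq> M"
      "\<And>n. M \<subseteq> (\<Union>x\<in>F n. mball x (inverse (Suc n)))"
    by metis
  define \<B> where "\<B> = (\<Union>n. (\<lambda>x. mball x (inverse (Suc n))) ` F n)"
  show thesis
  proof
    show "countable \<B>"
      using F(1) by (auto simp: \<B>_def intro: countable_finite)
    show "openin Y B \<and> B \<noteq> {}" if "B \<in> \<B>" for B
      using that F(2) by (force simp: \<B>_def Y mball_eq_empty)
    fix V assume V: "openin Y V" "V \<noteq> {}"
    then obtain v r where v: "v \<in> V" "v \<in> M" "r > 0" "mball v r \<subseteq> V"
      unfolding Y openin_mtopology by blast
    \<comment> \<open>Half of \<open>r\<close> suffices: a ball of this radius containing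
      \<open>v\<close> lies within distance \<open>r\<close> of \<open>v\<close>.\<close>
    obtain n where n: "inverse (real (Suc n)) < r / 2"
      using v reals_Archimedean [of "r / 2"] by auto
    obtain x where x: "x \<in> F n" "v \<in> mball x (inverse (Suc n))"
      using F(3) v by blast
    have "mball x (inverse (Suc n)) \<subseteq> mball v r"
    proof
      fix z assume z: "z \<in> mball x (inverse (Suc n))"
      then have "d v z \<le> d x v + d x z"
        using x by (metis commute in_mball triangle)
      then show "z \<in> mball v r"
        using x z n by (auto simp: in_mball)
    qed
    then show "\<exists>B\<in>\<B>. B \<subseteq> V"
      using x v by (auto simp: \<B>_def)
  qed
qed

text \<open>A proper subcontinuum through \<open>x\<close> misses some \<open>B\<close> in
  \<open>\<B>\<close>, so it lies in the component of \<open>x\<close> in the complement of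
  \<open>B\<close>. The composant is thus covered by countably many closed sets with empty interior,
  and the Baire category theorem applies.\<close>

lemma indecomposable_composant_proper:
  assumes Y: "compact_space Y" "connected_space Y" "metrizable_space Y" "indecomposable Y"
    and x: "x \<in> topspace Y"
  shows "composant Y x \<noteq> topspace Y"
proof -
  have H: "Hausdorff_space Y"
    using Y metrizable_imp_Hausdorff_space by blast
  obtain \<B> where \<B>: "countable \<B>" "\<And>B. B \<in> \<B> \<Longrightarrow> openin Y B \<and> B \<noteq> {}"
      "\<And>V. openin Y V \<Longrightarrow> V \<noteq> {} \<Longrightarrow> \<exists>B\<in>\<B>. B \<subseteq> V"
    using compact_metrizable_countable_pi_base Y by metis
  define C where "C B = connected_component_of_set (subtopology Y (topspace Y - B)) x" for B
  \<comment> \<open>The restriction \<open>x \<notin> B\<close> puts \<open>x\<close> into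
    \<open>C B\<close>, so every member of \<open>\<G>\<close> is a proper subcontinuum.\<close>
  define \<G> where "\<G> = C ` {B \<in> \<B>. x \<notin> B}"
  have "composant Y x \<subseteq> \<Union>\<G>"
  proof
    fix z assume "z \<in> composant Y x"
    then obtain K where K: "subcontinuum Y K" "K \<noteq> topspace Y" "x \<in> K" "z \<in> K"
      by (auto simp: composant_def)
    have "openin Y (topspace Y - K)" "topspace Y - K \<noteq> {}"
      using K H subcontinuum_closedin subcontinuum_subset_topspace by blast+
    then obtain B where B: "B \<in> \<B>" "B \<subseteq> topspace Y - K"
      using \<B>(3) by blast
    then have "connectedin (subtopology Y (topspace Y - B)) K"
      using K subcontinuum_subset_topspace [OF K(1)]
      by (auto simp: connectedin_subtopology subcontinuum_def)
    then have "K \<subseteq> C B"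
      using K(3) by (simp add: C_def connected_component_of_maximal)
    then show "z \<in> \<Union>\<G>"
      using K B by (auto simp: \<G>_def)
  qed
  moreover have "Y interior_of \<Union>\<G> = {}"
  proof (rule Baire_category_alt)
    show "completely_metrizable_space Y \<or> locally_compact_space Y \<and> regular_space Y"
      using Y compact_imp_locally_compact_space metrizable_imp_regular_space by blast
    show "countable \<G>"
      using \<B>(1) by (simp add: \<G>_def)
    fix T assume "T \<in> \<G>"
    then obtain B where B: "B \<in> \<B>" "x \<notin> B" "T = C B"
      by (auto simp: \<G>_def)
    have xB: "x \<in> topspace (subtopology Y (topspace Y - B))"
      using B x by simp
    have "closedin Y (topspace Y - B)"
      using \<B>(2) B by blast
    then have clT: "closedin Y T"
      unfolding B(3) C_def by (rule closedin_trans_full [OF closedin_connected_component_of])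
    have "connectedin (subtopology Y (topspace Y - B)) T"
      unfolding B(3) C_def by (rule connectedin_connected_component_of)
    then have "connectedin Y T" "T \<subseteq> topspace Y - B"
      by (simp_all add: connectedin_subtopology)
    moreover have "x \<in> T"
      unfolding B(3) C_def using xB by (simp add: connected_component_of_refl)
    moreover have "topspace Y - B \<noteq> topspace Y"
      using \<B>(2) [OF B(1)] openin_subset [of Y B] by blast
    ultimately have "subcontinuum Y T" "T \<noteq> topspace Y"
      using clT Y closedin_compact_space by (auto simp: subcontinuum_def)
    then show "closedin Y T \<and> Y interior_of T = {}"
      using clT indecomposable_interior_of_empty Y H by blast
  qed
  ultimately show ?thesis
    using x by (metis empty_iff interior_of_mono interior_of_topspace subset_empty)
qed

section \<open>The characterization\<close>

lemma indecomposable_imp_filament_properties: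
  assumes Y: "continuum Y" "indecomposable Y"
  shows "filament_additive Y \<and> filamentable Y \<and>
    (\<forall>x\<in>topspace Y. singular_dense_in Y (filament_composant Y x))"
proof (intro conjI ballI)
  have Y': "compact_space Y" "connected_space Y" "metrizable_space Y" "Hausdorff_space Y"
    using Y metrizable_imp_Hausdorff_space by (auto simp: continuum_def)
  have nondeg: "topspace Y \<noteq> {x}" for x
    using Y by (auto simp: continuum_def)
  note fil_iff = indecomposable_filament_iff [OF Y'(1,2,4) Y(2)]
  show "filament_additive Y"
    unfolding filament_additive_def
    using fil_iff indecomposable_union_proper [OF Y(2)] subcontinuum_Un filament_imp_subcontinuum
    by metis
  show "filamentable Y"
  proof -
    obtain p where p: "p \<in> topspace Y"
      using Y by (auto simp: continuum_def)
    \<comment> \<open>Any one-point set serves as \<open>L\<close>: a subcontinuum of its complement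
      misses \<open>p\<close>, so it is proper and therefore filament.\<close>
    have "filament Y {p}"
      using fil_iff p nondeg subcontinuum_singleton by metis
    moreover have "filament_set Y (topspace Y - {p})"
      using fil_iff p by (auto simp: filament_set_def)
    ultimately show ?thesis
      unfolding filamentable_def by blast
  qed
  fix x assume x: "x \<in> topspace Y"
  define X where "X = composant Y x"
  have "filament_composant Y x = X"
    unfolding X_def filament_composant_def composant_def
    using fil_iff filament_imp_subcontinuum by blast
  moreover have "singular_dense_in Y X"
    unfolding singular_dense_in_def singular_in_def singular_wrt_def
  proof (intro conjI)
    show dense: "Y closure_of X = topspace Y"
      using composant_dense [OF Y'(1,2,4) x nondeg] by (simp add: X_def)
    \<comment> \<open>Any point outside the composant witnesses singularity.\<close>
    obtain y where y: "y \<in> topspace Y" "y \<notin> X"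
      using indecomposable_composant_proper [OF Y'(1,2,3) Y(2) x] composant_subset_topspace [of Y x]
      unfolding X_def by blast
    have "subtopology Y X closure_of C = X"
      if C: "C \<subseteq> X" "connectedin Y C" "y \<in> Y closure_of C" for C
    proof -
      have "C \<noteq> {}"
        using C by auto
      then have sub: "subcontinuum Y (Y closure_of C)"
        using C Y' subcontinuum_closure_of by blast
      have CY: "C \<subseteq> Y closure_of C"
        using connectedin_subset_topspace [OF C(2)] closure_of_subset [of C Y] by blast
      obtain c K where K: "c \<in> C" "subcontinuum Y K" "K \<noteq> topspace Y" "x \<in> K" "c \<in> K"
        using C(1) \<open>C \<noteq> {}\<close> unfolding X_def composant_def by blast
      \<comment> \<open>If the closure of \<open>C\<close> were proper, its union with
        \<open>K\<close> would be a proper subcontinuum joining \<open>x\<close> to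
        \<open>y\<close>, which would place \<open>y\<close> in the composant.\<close>
      have "Y closure_of C = topspace Y"
      proof (rule ccontr)
        assume "Y closure_of C \<noteq> topspace Y"
        then have "subcontinuum Y (K \<union> Y closure_of C)" "K \<union> Y closure_of C \<noteq> topspace Y"
          using K sub CY indecomposable_union_proper [OF Y(2)] subcontinuum_Un by blast+
        then have "y \<in> X"
          unfolding X_def composant_def using K C(3) by blast
        then show False
          using y by blast
      qed
      then show ?thesis
        using C(1) composant_subset_topspace [of Y x]
        by (simp add: closure_of_subtopology Int_absorb1 X_def inf_absorb1 inf_absorb2)
    qed
    then show "\<exists>y\<in>topspace Y. connectedin Y X \<and> y \<in> topspace Y \<and>
        (\<forall>C. C \<subseteq> X \<and> connectedin Y C \<and> y \<in> Y closure_of C \<longrightarrow> subtopology Y X closure_of C = X)"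
      using y connectedin_composant [of Y x] by (intro bexI [of _ y]) (simp_all add: X_def)
  qed
  ultimately show "singular_dense_in Y (filament_composant Y x)"
    by simp
qed

lemma filament_properties_imp_indecomposable:
  assumes Y: "continuum Y" "homogeneous Y"
    and add: "filament_additive Y" and "filamentable Y"
    and sing: "\<And>x. x \<in> topspace Y \<Longrightarrow> singular_dense_in Y (filament_composant Y x)"
  shows "indecomposable Y"
  unfolding indecomposable_def
proof
  have Y': "compact_space Y" "connected_space Y" "Hausdorff_space Y"
    using Y metrizable_imp_Hausdorff_space by (auto simp: continuum_def)
  have move: "\<exists>h. homeomorphic_map Y Y h \<and> h x = y" if "x \<in> topspace Y" "y \<in> topspace Y" for x y
    using Y that by (auto simp: homogeneous_def)
  obtain L where L: "filament Y L" "filament_set Y (topspace Y - L)"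
    using \<open>filamentable Y\<close> by (auto simp: filamentable_def)
  then obtain l where l: "l \<in> L" "l \<in> topspace Y"
    using filament_imp_subcontinuum [of Y L] subcontinuum_subset_topspace [of Y L]
    by (auto simp: subcontinuum_def)
  \<comment> \<open>Move \<open>L\<close> by a homeomorphism taking \<open>l\<close> to
    \<open>x\<close>. A non-filament \<open>M\<close> disjoint from the image would pull back to a
    continuum in the filament set \<open>topspace Y - L\<close>, hence to a filament one.\<close>
  have transversal: "\<exists>L'. filament Y L' \<and> x \<in> L' \<and>
      (\<forall>M. subcontinuum Y M \<and> \<not> filament Y M \<longrightarrow> M \<inter> L' \<noteq> {})" if x: "x \<in> topspace Y" for x
  proof -
    obtain h where h: "homeomorphic_map Y Y h" "h l = x"
      using move l x by blast
    have "M \<inter> h ` L \<noteq> {}" if M: "subcontinuum Y M" "\<not> filament Y M" for M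
    proof
      assume disj: "M \<inter> h ` L = {}"
      have MY: "M \<subseteq> topspace Y"
        using M subcontinuum_subset_topspace by blast
      obtain g where g: "homeomorphic_map Y Y g" "\<forall>x\<in>topspace Y. h (g x) = x"
        using homeomorphic_map_inverse h by blast
      have "subcontinuum Y (g ` M)"
        using g M subcontinuum_image by blast
      moreover have "g ` M \<inter> L = {}"
        using disj g(2) MY by (force simp: image_iff)
      ultimately have "filament Y (g ` M)"
        using L(2) subcontinuum_subset_topspace unfolding filament_set_def by blast
      then show False
        using M filament_image_iff [OF g(1) MY] by blast
    qed
    then show ?thesis
      using filament_image [OF h(1) L(1)] h(2) l(1) by blast
  qed
  assume "decomposable Y"
  then obtain H K where HK: "subcontinuum Y H" "subcontinuum Y K" "H \<subset> topspace Y" "K \<subset> topspace Y"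
      "topspace Y = H \<union> K"
    unfolding decomposable_def by blast
  \<comment> \<open>The complement of \<open>K\<close> is a non-empty open subset of
    \<open>H\<close>, whereas filament continua have empty interior.\<close>
  have "openin Y (topspace Y - K)"
    using HK Y' subcontinuum_closedin by blast
  moreover have "topspace Y - K \<subseteq> H"
    using HK by blast
  ultimately have "topspace Y - K \<subseteq> Y interior_of H"
    by (simp add: interior_of_maximal)
  then have "\<not> filament Y H"
    using HK filament_interior_of_empty by blast
  then obtain M0 where M0: "subcontinuum Y M0" "M0 \<subseteq> H" "\<not> filament Y M0"
      "\<And>K. subcontinuum Y K \<Longrightarrow> K \<subset> M0 \<Longrightarrow> filament Y K"
    using minimal_nonfilament_exists [OF Y'(1,3) HK(1)] by metis
  define X where "X = filament_composant Y l"
  have dense: "Y closure_of X = topspace Y"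
    using sing l by (simp add: X_def singular_dense_in_def)
  obtain y where y: "y \<in> topspace Y" "singular_wrt Y X y"
    using sing [OF l(2)] unfolding X_def singular_dense_in_def singular_in_def by blast
  \<comment> \<open>An arbitrary point of \<open>M0\<close> is moved to \<open>y\<close>, so that
    the minimal continuum \<open>M\<close> passes through the singularity point.\<close>
  obtain z where z: "z \<in> M0" "z \<in> topspace Y"
    using M0(1) subcontinuum_subset_topspace [OF M0(1)] by (auto simp: subcontinuum_def)
  obtain h where h: "homeomorphic_map Y Y h" "h z = y"
    using move z y by blast
  define M where "M = h ` M0"
  have M: "subcontinuum Y M" "\<not> filament Y M" "y \<in> M"
      "\<And>K. subcontinuum Y K \<Longrightarrow> K \<subset> M \<Longrightarrow> filament Y K"
    unfolding M_def
    using minimal_nonfilament_image [OF h(1) M0(1,3,4)] subcontinuum_image [OF h(1) M0(1)] h z by auto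
  have MY: "M \<subseteq> topspace Y" and clM: "closedin Y M"
    using M Y' subcontinuum_subset_topspace subcontinuum_closedin by blast+
  have "M \<noteq> topspace Y"
  proof
    assume "M = topspace Y"
    then have "h ` M0 = h ` topspace Y"
      using h homeomorphic_imp_surjective_map unfolding M_def by blast
    then have "M0 = topspace Y"
      using inj_on_image_eq_iff [OF homeomorphic_imp_injective_map [OF h(1)]]
        subcontinuum_subset_topspace [OF M0(1)] by blast
    then show False
      using M0(2) HK by blast
  qed
  \<comment> \<open>Since \<open>L'\<close> is filament and contains \<open>l\<close>, it lies in
    \<open>X\<close>; it links \<open>l\<close> to a point \<open>p\<close> of
    \<open>M\<close>.\<close>
  obtain L' where L': "filament Y L'" "l \<in> L'" "M \<inter> L' \<noteq> {}"
    using transversal [OF l(2)] M by meson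
  then obtain p where p: "p \<in> M" "p \<in> L'" by blast
  define C where "C = composant (subtopology Y M) p"
  have topM: "topspace (subtopology Y M) = M"
    using MY by auto
  \<comment> \<open>Non-degeneracy of \<open>M\<close> is what makes the composant of
    \<open>p\<close> dense in \<open>M\<close>. A one-point \<open>M\<close> would be a subcontinuum
    of the filament \<open>L'\<close>.\<close>
  have "M \<noteq> {p}"
  proof
    assume "M = {p}"
    then have "filament Y M"
      using filament_mono [OF L'(1) M(1)] p by auto
    then show False
      using M by blast
  qed
  then have "subtopology Y M closure_of C = M"
    unfolding C_def using composant_dense [of "subtopology Y M" p] M(1) p Y' topM
    by (auto simp: subcontinuum_def compact_space_subtopology connectedin_def Hausdorff_space_subtopology)
  then have MC: "M \<subseteq> Y closure_of C"
    using closure_of_subtopology_subset by metis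
  have "C \<subseteq> M"
    using composant_subset_topspace topM unfolding C_def by metis
  \<comment> \<open>A proper subcontinuum \<open>K\<close> of \<open>M\<close> through
    \<open>p\<close> is filament by minimality and meets \<open>L'\<close> in \<open>p\<close>.
    Additivity makes \<open>K \<union> L'\<close> a filament continuum containing
    \<open>l\<close>.\<close>
  have "C \<subseteq> X"
  proof
    fix c assume "c \<in> C"
    then obtain K where K: "subcontinuum Y K" "K \<subset> M" "p \<in> K" "c \<in> K"
      unfolding C_def composant_def subcontinuum_subtopology topM by blast
    then have "filament Y (K \<union> L')"
      using add L' p M(4) unfolding filament_additive_def by blast
    then show "c \<in> X"
      unfolding X_def filament_composant_def using K L' by blast
  qed
  moreover have "connectedin Y C"
    using connectedin_composant [of "subtopology Y M" p] by (simp add: C_def connectedin_subtopology)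
  \<comment> \<open>This triggers singularity at \<open>y\<close>: \<open>C\<close> becomes dense in
    \<open>X\<close>, so the dense set \<open>X\<close> lies in the closed proper set
    \<open>M\<close>.\<close>
  moreover have "y \<in> Y closure_of C"
    using M MC by blast
  ultimately have "subtopology Y X closure_of C = X"
    using y(2) unfolding singular_wrt_def by blast
  then have "X \<subseteq> Y closure_of C"
    using closure_of_subtopology_subset by metis
  moreover have "Y closure_of C \<subseteq> M"
    using \<open>C \<subseteq> M\<close> clM closure_of_minimal by blast
  ultimately have "topspace Y \<subseteq> M"
    using dense clM closure_of_minimal by (metis order_trans)
  then show False
    using MY \<open>M \<noteq> topspace Y\<close> by blast
qed

theorem theorem1p5:
  fixes Y :: "'a topology"
  assumes "continuum Y" and "homogeneous Y"
  shows "indecomposable Y \<longleftrightarrow>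
    filament_additive Y \<and> filamentable Y \<and>
    (\<forall>x\<in>topspace Y. singular_dense_in Y (filament_composant Y x))"
  using assms indecomposable_imp_filament_properties filament_properties_imp_indecomposable
  by blast

end
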